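(* Let $n,m\ge 2$ be integers and let $G=P_n\boxtimes P_m$ be the strong product of the paths $P_n$ and $P_m$ on $n$ and $m$ vertices. Then $G$ is just a frame graph in the inner product spaces of dimension $(n-1)(m-1),(n-1)(m-1)+1,\dots,mn-1,mn$; that is, for each $\mathbb{F}\in\{\mathbb{R},\mathbb{C}\}$ and each integer $d\ge 1$, $G$ is a frame graph in a $d$-dimensional inner product space over $\mathbb{F}$ if and only if $(n-1)(m-1)\le d\le mn$.
   Context: All graphs are finite, simple, connected and have more than one vertex. A finite frame for a finite-dimensional inner product space $\mathcal{H}$ over $\mathbb{R}$ or $\mathbb{C}$ is a finite sequence $\varphi=(f_i)_{i=1}^N$ in $\mathcal{H}$ for which there are constants $0<A\le B<\infty$ with $A\|f\|^2\le\sum_{i=1}^N|\langle f,f_i\rangle|^2\le B\|f\|^2$ for all $f\in\mathcal{H}$ (equivalently, a finite sequence spanning $\mathcal{H}$; repeated vectors are allowed and count as different vertices). Its frame graph $G(\varphi)$ has the elements $f_1,\dots,f_N$ of the sequence as vertices, and for $i\ne j$, $f_i$ and $f_j$ are adjacent iff $\langle f_i,f_j\rangle\ne 0$. A graph $G$ is a frame graph in $\mathcal{H}$ if there is a finite frame $\varphi$ for $\mathcal{H}$ with $G(\varphi)=G$ (up to labelling of vertices). The strong product $G_1\boxtimes G_2$ of $G_1=(V_1,E_1)$ and $G_2=(V_2,E_2)$ has vertex set $V_1\times V_2$, with $(u,v)$ adjacent to $(u',v')$ iff (1) $u=u'$ and $\{v,v'\}\in E_2$, or (2) $v=v'$ and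 $\{u,u'\}\in E_1$, or (3) $\{u,u'\}\in E_1$ and $\{v,v'\}\in E_2$. *)

theory Defs
  imports "HOL-Analysis.Analysis" "Jordan_Normal_Form.Conjugate"
begin

section \<open>Graphs\<close>

text \<open>A graph is given by its vertex set and its set of edges, each edge being a two-element
  set of vertices.\<close>

type_synonym 'a graph = "'a set \<times> 'a set set"

abbreviation verts :: "'a graph \<Rightarrow> 'a set" where "verts G \<equiv> fst G"
abbreviation edges :: "'a graph \<Rightarrow> 'a set set" where "edges G \<equiv> snd G"

definition graph_isomorphic :: "'a graph \<Rightarrow> 'b graph \<Rightarrow> bool" where
  "graph_isomorphic G H \<longleftrightarrow>
     (\<exists>h. bij_betw h (verts G) (verts H) \<and>
          (\<forall>u\<in>verts G. \<forall>v\<in>verts G. {u, v} \<in> edges G \<longleftrightarrow> {h u, h v} \<in> edges H))"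

definition path_graph :: "nat \<Rightarrow> nat graph" where
  "path_graph n = ({..<n}, {{i, Suc i} |i. Suc i < n})"

definition strong_product :: "'a graph \<Rightarrow> 'b graph \<Rightarrow> ('a \<times> 'b) graph" where
  "strong_product G H =
     (verts G \<times> verts H,
      {{(u, v), (u', v')} |u v u' v'.
         u \<in> verts G \<and> u' \<in> verts G \<and> v \<in> verts H \<and> v' \<in> verts H \<and>
         (u = u' \<and> {v, v'} \<in> edges H \<or>
          v = v' \<and> {u, u'} \<in> edges G \<or>
          {u, u'} \<in> edges G \<and> {v, v'} \<in> edges H)})"

section \<open>Inner product spaces over the real or complex numbers\<close>

text \<open>The sort of scalars is instantiated by the real numbers (conjugation is the identity) and
  by the complex numbers (conjugation is \<open>cnj\<close>). The order on the complex numbers is the one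
  from \<^theory>\<open>HOL-Library.Complex_Order\<close>, so \<open>0 < z\<close> means that \<open>z\<close> is real and
  positive.\<close>

locale inner_product_space = vector_space sc
  for sc :: "'k::{real_normed_field, conjugatable_ordered_field} \<Rightarrow> 'v::ab_group_add \<Rightarrow> 'v" +
  fixes ip :: "'v \<Rightarrow> 'v \<Rightarrow> 'k"
  assumes ip_add_left: "ip (x + y) z = ip x z + ip y z"
    and ip_scale_left: "ip (sc a x) z = a * ip x z"
    and ip_conjugate: "ip y x = conjugate (ip x y)"
    and ip_pos: "x \<noteq> 0 \<Longrightarrow> 0 < ip x x"

definition inner_product_space_of_dim ::
  "nat \<Rightarrow> ('k::{real_normed_field, conjugatable_ordered_field} \<Rightarrow> 'v::ab_group_add \<Rightarrow> 'v) \<Rightarrow>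
   ('v \<Rightarrow> 'v \<Rightarrow> 'k) \<Rightarrow> bool" where
  "inner_product_space_of_dim d sc ip \<longleftrightarrow>
     inner_product_space sc ip \<and>
     (\<exists>B. finite_dimensional_vector_space sc B \<and> card B = d)"

text \<open>For each nonzero \<open>d\<close> the notion is inhabited: take the coordinate space over an index
  type with \<open>d\<close> elements.\<close>

lemma inner_product_space_of_dim_real_vec:
  "inner_product_space_of_dim CARD('n) ((*s) :: real \<Rightarrow> real ^ 'n \<Rightarrow> real ^ 'n)
     (\<lambda>x y. \<Sum>i\<in>UNIV. x $ i * conjugate (y $ i))"
  unfolding inner_product_space_of_dim_def
proof
  show "inner_product_space ((*s) :: real \<Rightarrow> real ^ 'n \<Rightarrow> real ^ 'n)
     (\<lambda>x y. \<Sum>i\<in>UNIV. x $ i * conjugate (y $ i))"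
  proof
    fix x :: "real ^ 'n" assume "x \<noteq> 0"
    then obtain j where "x $ j \<noteq> 0" by (auto simp: vec_eq_iff)
    then show "0 < (\<Sum>i\<in>UNIV. x $ i * conjugate (x $ i))"
      by (intro sum_pos2[of _ j]) (auto simp: zero_less_mult_iff linorder_neq_iff)
  qed (auto simp: sum.distrib sum_distrib_left algebra_simps intro!: sum.cong)
  show "\<exists>B. finite_dimensional_vector_space ((*s) :: real \<Rightarrow> real ^ 'n \<Rightarrow> real ^ 'n) B \<and>
      card B = CARD('n)"
    using vec.finite_dimensional_vector_space_axioms card_cart_basis by blast
qed

lemma inner_product_space_of_dim_complex_vec:
  "inner_product_space_of_dim CARD('n) ((*s) :: complex \<Rightarrow> complex ^ 'n \<Rightarrow> complex ^ 'n)
     (\<lambda>x y. \<Sum>i\<in>UNIV. x $ i * conjugate (y $ i))"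
  unfolding inner_product_space_of_dim_def
proof
  show "inner_product_space ((*s) :: complex \<Rightarrow> complex ^ 'n \<Rightarrow> complex ^ 'n)
     (\<lambda>x y. \<Sum>i\<in>UNIV. x $ i * conjugate (y $ i))"
  proof
    fix x :: "complex ^ 'n" assume "x \<noteq> 0"
    then obtain j where "x $ j \<noteq> 0" by (auto simp: vec_eq_iff)
    then show "0 < (\<Sum>i\<in>UNIV. x $ i * conjugate (x $ i))"
      using conjugate_square_greater_0[of "x $ j"]
      by (intro sum_pos2[of _ j]) (auto simp: conjugate_square_positive simp del: conjugate_complex_def)
  qed (auto simp: sum.distrib sum_distrib_left algebra_simps intro!: sum.cong)
  show "\<exists>B. finite_dimensional_vector_space ((*s) :: complex \<Rightarrow> complex ^ 'n \<Rightarrow> complex ^ 'n) B \<and>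
      card B = CARD('n)"
    using vec.finite_dimensional_vector_space_axioms card_cart_basis by blast
qed

section \<open>Frames and frame graphs\<close>

text \<open>The squared norm of \<open>f\<close> is the modulus of the nonnegative real scalar \<open>ip f f\<close>. A finite
  sequence is a list, whose entries need not be distinct.\<close>

definition finite_frame :: "('v \<Rightarrow> 'v \<Rightarrow> 'k::real_normed_field) \<Rightarrow> 'v list \<Rightarrow> bool" where
  "finite_frame ip fs \<longleftrightarrow>
     (\<exists>A B::real. 0 < A \<and> A \<le> B \<and>
        (\<forall>f. A * norm (ip f f) \<le> (\<Sum>i<length fs. (norm (ip f (fs ! i)))\<^sup>2) \<and>
             (\<Sum>i<length fs. (norm (ip f (fs ! i)))\<^sup>2) \<le> B * norm (ip f f)))"

text \<open>The vertices are the positions in the sequence, so that repeated vectors give different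
  vertices.\<close>

definition frame_graph :: "('v \<Rightarrow> 'v \<Rightarrow> 'k::zero) \<Rightarrow> 'v list \<Rightarrow> nat graph" where
  "frame_graph ip fs =
     ({..<length fs},
      {{i, j} |i j. i < length fs \<and> j < length fs \<and> i \<noteq> j \<and> ip (fs ! i) (fs ! j) \<noteq> 0})"

definition is_frame_graph_in :: "'a graph \<Rightarrow> ('v \<Rightarrow> 'v \<Rightarrow> 'k::real_normed_field) \<Rightarrow> bool" where
  "is_frame_graph_in G ip \<longleftrightarrow>
     (\<exists>fs. finite_frame ip fs \<and> graph_isomorphic (frame_graph ip fs) G)"

end

theory Submission
  imports Defs
begin

text \<open>
  A frame spans, so \<open>d \<le> m * n\<close>. For the lower bound, the vectors of the vertices
  \<open>(i, j)\<close> with \<open>i < n - 1\<close> and \<open>j < m - 1\<close> are linearly independent: in a vanishing linear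
  combination, pick an \<open>(i, j)\<close> with nonzero coefficient and \<open>i + j\<close> maximal; among the vertices
  with nonzero coefficient it is the only one that is adjacent or equal to \<open>(i + 1, j + 1)\<close>.

  Conversely, choose \<open>d\<close> of the vertices, among them all the \<open>(i, j)\<close> with \<open>i < n - 1\<close> and
  \<open>j < m - 1\<close>, and index an orthonormal basis by the chosen vertices. An index
  \<open>(i, j)\<close> of this special kind stands for the unit square (a maximal clique) with lower left
  corner \<open>(i, j)\<close>, every other index just for the vertex itself. Giving each vertex the sum of the
  basis vectors whose square (or vertex) contains it, the inner product of two of
  these vectors counts the common squares, and the family spans by triangularity.
\<close>

section \<open>Inner product spaces\<close>

context inner_product_space
begin

section \<open>Sesquilinearity and definiteness\<close>

lemma ip_zero_left [simp]: "ip 0 x = 0"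
  using ip_add_left[of 0 0 x] by simp

lemma ip_zero_right [simp]: "ip x 0 = 0"
  using ip_conjugate[of x 0] by simp

lemma ip_eq_0_sym: "ip x y = 0 \<longleftrightarrow> ip y x = 0"
  using ip_conjugate[of x y] by simp

lemma ip_self_eq_0: "ip x x = 0 \<longleftrightarrow> x = 0"
  using ip_pos[of x] by (metis ip_zero_left less_irrefl)

lemma ip_add_right: "ip x (y + z) = ip x y + ip x z"
  by (metis ip_conjugate ip_add_left conjugate_dist_add)

lemma ip_scale_right: "ip x (sc a y) = conjugate a * ip x y"
  by (metis ip_conjugate ip_scale_left conjugate_dist_mul)

lemma ip_diff_left: "ip (x - y) z = ip x z - ip y z"
  using ip_add_left[of "x - y" y z] by (simp add: algebra_simps)

lemma ip_sum_left: "ip (\<Sum>i\<in>A. f i) y = (\<Sum>i\<in>A. ip (f i) y)"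
  by (induction A rule: infinite_finite_induct) (auto simp: ip_add_left)

lemma ip_sum_right: "ip y (\<Sum>i\<in>A. f i) = (\<Sum>i\<in>A. ip y (f i))"
  by (induction A rule: infinite_finite_induct) (auto simp: ip_add_right)

section \<open>Orthogonal projections onto spans\<close>

lemma ip_span_eq_0:
  assumes "y \<in> span S" and "\<And>s. s \<in> S \<Longrightarrow> ip x s = 0"
  shows "ip x y = 0"
  using assms(1) by (induction rule: span_induct_alt) (auto simp: ip_add_right ip_scale_right assms)

text \<open>A Gram-Schmidt step: the projection onto the span of \<open>S\<close> is corrected along
  \<open>w\<close>, the part of \<open>a\<close> orthogonal to \<open>S\<close>.\<close>

lemma orthogonal_projection_exists:
  assumes "finite S"
  shows "\<exists>y\<in>span S. \<forall>s\<in>S. ip (x - y) s = 0"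
  using assms
proof (induction S arbitrary: x)
  case empty
  show ?case by (auto intro: span_zero)
next
  case (insert a S)
  obtain y where y: "y \<in> span S" "\<And>s. s \<in> S \<Longrightarrow> ip (x - y) s = 0" using insert.IH by blast
  obtain b where b: "b \<in> span S" "\<And>s. s \<in> S \<Longrightarrow> ip (a - b) s = 0" using insert.IH by blast
  define w where "w = a - b"
  define y' where "y' = y + sc (ip (x - y) w / ip w w) w"
  have mono: "z \<in> span (insert a S)" if "z \<in> span S" for z
    using that span_mono[of S "insert a S"] by blast
  have "w \<in> span (insert a S)"
    unfolding w_def by (intro span_diff mono[OF b(1)]) (auto intro: span_base)
  then have mem: "y' \<in> span (insert a S)"
    unfolding y'_def by (intro span_add span_scale mono[OF y(1)])
  have eq: "ip (x - y') z = ip (x - y) z - ip (x - y) w / ip w w * ip w z" for z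
    by (simp add: y'_def ip_diff_left ip_add_left ip_scale_left)
  have orth: "ip (x - y') s = 0" if "s \<in> S" for s
    using that by (simp add: eq y(2) b(2) w_def)
  \<comment> \<open>The coefficient of \<open>w\<close> is chosen for this cancellation. For
    \<open>w = 0\<close> division by zero gives 0 and the claim is trivial.\<close>
  have "ip (x - y') w = 0"
    by (cases "w = 0") (simp_all add: eq ip_self_eq_0)
  moreover have "ip (x - y') b = 0" using ip_span_eq_0[OF b(1)] orth by blast
  moreover have "a = w + b" by (simp add: w_def)
  ultimately have "ip (x - y') a = 0" by (simp add: ip_add_right)
  with orth mem show ?case by blast
qed

text \<open>The difference of \<open>x\<close> and its projection is orthogonal to \<open>S\<close>,
  hence zero.\<close>

lemma span_eq_UNIV_if_orthogonal_trivial: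
  assumes "finite S" and "\<And>x. (\<And>s. s \<in> S \<Longrightarrow> ip x s = 0) \<Longrightarrow> x = 0"
  shows "span S = UNIV"
proof -
  have "x \<in> span S" for x
    using orthogonal_projection_exists[OF assms(1), of x] assms(2) by fastforce
  then show ?thesis by blast
qed

section \<open>Inequalities behind the frame bounds\<close>

lemma finite_frame_orthogonal_trivial:
  assumes "finite_frame ip fs" and "\<And>f. f \<in> set fs \<Longrightarrow> ip x f = 0"
  shows "x = 0"
proof -
  obtain A :: real where A: "0 < A"
    "A * norm (ip x x) \<le> (\<Sum>i<length fs. (norm (ip x (fs ! i)))\<^sup>2)"
    using assms(1) unfolding finite_frame_def by metis
  have "(\<Sum>i<length fs. (norm (ip x (fs ! i)))\<^sup>2) = 0" using assms(2) by simp
  with A have "norm (ip x x) \<le> 0" by (simp add: mult_le_0_iff)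
  then show ?thesis by (simp add: ip_self_eq_0)
qed

text \<open>Serves both frame inequalities: \<open>f\<close> may enumerate a spanning list or an
  orthonormal basis. \<open>C\<close> depends on \<open>x\<close> but not on \<open>y\<close>; it is
  built up along a linear combination representing \<open>x\<close>.\<close>

lemma norm_ip_span_bound:
  assumes "finite I" and "x \<in> span (f ` I)"
  shows "\<exists>C. 0 < C \<and> (\<forall>y. (norm (ip y x))\<^sup>2 \<le> C * (\<Sum>i\<in>I. (norm (ip y (f i)))\<^sup>2))"
  using assms(2)
proof (induction rule: span_induct_alt)
  case base
  show ?case by (auto intro!: exI[of _ 1] sum_nonneg)
next
  case (step c s z)
  define Q where "Q y = (\<Sum>i\<in>I. (norm (ip y (f i)))\<^sup>2)" for y
  obtain C where C: "0 < C" "\<And>y. (norm (ip y z))\<^sup>2 \<le> C * Q y"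
    using step.IH unfolding Q_def by blast
  obtain i where i: "i \<in> I" "s = f i" using step.hyps by blast
  have Qnn: "0 \<le> Q y" for y unfolding Q_def by (intro sum_nonneg) auto
  \<comment> \<open>The factors 2 come from \<open>(a + b)^2 \<le> 2 * a^2 + 2 * b^2\<close>, the
    conjugate from scaling in the second argument.\<close>
  define D where "D = 2 * (norm (conjugate c))\<^sup>2 + 2 * C"
  have "(norm (ip y (sc c s + z)))\<^sup>2 \<le> D * Q y" for y
  proof -
    have s: "(norm (ip y s))\<^sup>2 \<le> Q y"
      unfolding Q_def i(2) by (rule member_le_sum) (use i assms(1) in auto)
    have "norm (ip y (sc c s + z)) \<le> norm (conjugate c) * norm (ip y s) + norm (ip y z)"
      by (metis ip_add_right ip_scale_right norm_mult norm_triangle_ineq)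
    then have "(norm (ip y (sc c s + z)))\<^sup>2 \<le> (norm (conjugate c) * norm (ip y s) + norm (ip y z))\<^sup>2"
      by (rule power_mono) simp
    also have "\<dots> \<le> 2 * (norm (conjugate c) * norm (ip y s))\<^sup>2 + 2 * (norm (ip y z))\<^sup>2"
      using sum_squares_bound[of "norm (conjugate c) * norm (ip y s)" "norm (ip y z)"]
      by (simp add: power2_sum)
    also have "\<dots> \<le> 2 * ((norm (conjugate c))\<^sup>2 * Q y) + 2 * (C * Q y)"
      unfolding power_mult_distrib
      by (intro add_mono mult_left_mono s C(2)) auto
    finally show ?thesis by (simp add: D_def algebra_simps)
  qed
  moreover have "0 < D" unfolding D_def using C(1) by (intro add_nonneg_pos) auto
  ultimately show ?case unfolding Q_def by blast
qed

text \<open>Ordered by \<open>r\<close>, the matrix of products of \<open>f\<close> with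
  \<open>g\<close> is triangular with nonzero diagonal. In a vanishing combination, pairing with
  \<open>g k\<close>, for \<open>k\<close> of maximal rank in the support, isolates the coefficient
  of \<open>k\<close>. Injectivity gives the image the cardinality of \<open>I\<close>.\<close>

lemma independent_triangular:
  assumes "finite I" and "\<And>i. i \<in> I \<Longrightarrow> ip (f i) (g i) \<noteq> 0"
    and triangular: "\<And>i j. i \<in> I \<Longrightarrow> j \<in> I \<Longrightarrow> i \<noteq> j \<Longrightarrow> ip (f j) (g i) \<noteq> 0 \<Longrightarrow> (r i :: nat) < r j"
  shows "inj_on f I" and "independent (f ` I)"
proof -
  have zero: "c i = 0" if "(\<Sum>i\<in>I. sc (c i) (f i)) = 0" "i \<in> I" for c i
  proof (rule ccontr)
    assume "c i \<noteq> 0"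
    let ?J = "{i \<in> I. c i \<noteq> 0}"
    have "finite ?J" "?J \<noteq> {}" using assms(1) that \<open>c i \<noteq> 0\<close> by auto
    then have "Max (r ` ?J) \<in> r ` ?J" and "\<And>j. j \<in> ?J \<Longrightarrow> r j \<le> Max (r ` ?J)"
      by (intro Max_in Max_ge; blast)+
    then obtain k where k: "k \<in> ?J" "\<And>j. j \<in> ?J \<Longrightarrow> r j \<le> r k" by force
    have "0 = ip (\<Sum>i\<in>I. sc (c i) (f i)) (g k)" using that by simp
    also have "\<dots> = (\<Sum>i\<in>I. c i * ip (f i) (g k))" by (simp add: ip_sum_left ip_scale_left)
    also have "\<dots> = (\<Sum>i\<in>{k}. c i * ip (f i) (g k))"
    proof (rule sum.mono_neutral_right)
      show "\<forall>i\<in>I - {k}. c i * ip (f i) (g k) = 0"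
        using k triangular by (metis (mono_tags, lifting) Diff_iff insertI1 leD mem_Collect_eq mult_eq_0_iff)
    qed (use assms k in auto)
    finally show False using k assms(2) by auto
  qed
  show inj: "inj_on f I"
  proof (rule inj_onI, rule ccontr)
    fix i j assume ij: "i \<in> I" "j \<in> I" "f i = f j" "i \<noteq> j"
    \<comment> \<open>Two equal vectors would satisfy a nontrivial relation with coefficients 1 and
      -1.\<close>
    define c where "c l = (if l = i then 1 else if l = j then - 1 else 0 :: 'k)" for l
    have "(\<Sum>l\<in>I. sc (c l) (f l)) = (\<Sum>l\<in>{i, j}. sc (c l) (f l))"
      by (rule sum.mono_neutral_right) (use ij assms(1) in \<open>auto simp: c_def\<close>)
    also have "\<dots> = 0" using ij by (simp add: c_def)
    finally show False using zero[of c i] ij by (simp add: c_def)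
  qed
  show "independent (f ` I)"
  proof (rule independent_if_scalars_zero)
    fix u x assume *: "(\<Sum>x\<in>f ` I. sc (u x) x) = 0" and x: "x \<in> f ` I"
    have "(\<Sum>i\<in>I. sc (u (f i)) (f i)) = 0" using * by (simp add: sum.reindex[OF inj])
    then show "u x = 0" using zero[of "u \<circ> f"] x by auto
  qed (use assms in auto)
qed

end

text \<open>The two extra assumptions are what the real and the complex numbers have in common.\<close>

locale real_or_complex_ip_space = inner_product_space sc ip
  for sc :: "'k::{real_normed_field, conjugatable_ordered_field} \<Rightarrow> 'v::ab_group_add \<Rightarrow> 'v" and ip +
  assumes mult_conjugate: "z * conjugate z = of_real ((norm (z :: 'k))\<^sup>2)"
    and pos_eq_of_real: "0 < (z :: 'k) \<Longrightarrow> z = of_real (norm z)"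
begin

section \<open>Orthonormal bases and Parseval's identity\<close>

lemma conjugate_of_real: "conjugate (of_real r :: 'k) = of_real r"
proof (cases "r = 0")
  case False
  then have "of_real r * conjugate (of_real r :: 'k) = of_real r * of_real r"
    using mult_conjugate[of "of_real r"] by (simp add: power2_eq_square flip: of_real_mult)
  then show ?thesis using False by simp
qed simp

lemma normalize_vector:
  assumes "x \<noteq> 0"
  shows "\<exists>a. a \<noteq> 0 \<and> ip (sc a x) (sc a x) = 1"
proof -
  define r where "r = norm (ip x x)"
  have r: "r > 0" using assms by (simp add: r_def ip_self_eq_0)
  have ip: "ip x x = of_real r" using pos_eq_of_real[OF ip_pos[OF assms]] by (simp add: r_def)
  define a where "a = (of_real (1 / sqrt r) :: 'k)"
  have "ip (sc a x) (sc a x) = of_real (1 / sqrt r * (1 / sqrt r) * r)"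
    by (simp only: ip_scale_left ip_scale_right a_def conjugate_of_real ip of_real_mult mult.assoc)
  also have "1 / sqrt r * (1 / sqrt r) * r = 1" using r by simp
  finally show ?thesis using r by (intro exI[of _ a]) (auto simp: a_def)
qed

text \<open>Off-diagonal products vanish, so triangularity is vacuous and a constant rank
  suffices.\<close>

lemma independent_orthonormal:
  assumes "finite E" and "\<And>x y. x \<in> E \<Longrightarrow> y \<in> E \<Longrightarrow> ip x y = (if x = y then 1 else 0)"
  shows "independent E"
  using independent_triangular(2)[of E id id "\<lambda>_. 0"] assms by auto

text \<open>Fewer than \<open>card B\<close> vectors cannot span, so some nonzero vector is
  orthogonal to all of them; normalized, it extends the set.\<close>

lemma orthonormal_set_exists:
  assumes fd: "finite_dimensional_vector_space sc B" and "k \<le> card B"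
  shows "\<exists>E. finite E \<and> card E = k \<and> (\<forall>x\<in>E. \<forall>y\<in>E. ip x y = (if x = y then 1 else 0))"
  using assms(2)
proof (induction k)
  case 0
  show ?case by (intro exI[of _ "{}"]) auto
next
  case (Suc k)
  interpret fd: finite_dimensional_vector_space sc B by (fact fd)
  obtain E where E: "finite E" "card E = k" "\<And>x y. x \<in> E \<Longrightarrow> y \<in> E \<Longrightarrow> ip x y = (if x = y then 1 else 0)"
    using Suc by (metis Suc_leD)
  have "span E \<noteq> UNIV"
  proof
    assume "span E = UNIV"
    then have "dim (UNIV :: 'v set) \<le> card E" using E(1) dim_le_card[of UNIV E] by simp
    then show False using E(2) Suc.prems by (simp add: fd.dim_UNIV fd.dimension_def)
  qed
  then obtain x where x: "\<And>s. s \<in> E \<Longrightarrow> ip x s = 0" "x \<noteq> 0"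
    using span_eq_UNIV_if_orthogonal_trivial[OF E(1)] by blast
  obtain a where a: "a \<noteq> 0" "ip (sc a x) (sc a x) = 1" using normalize_vector[OF x(2)] by blast
  define e where "e = sc a x"
  have orth: "ip e s = 0" "ip s e = 0" if "s \<in> E" for s
    using x(1)[OF that] ip_eq_0_sym[of s x] by (auto simp: e_def ip_scale_left ip_scale_right)
  have "e \<notin> E" using orth a(2) unfolding e_def by force
  then show ?case
    using E orth a(2) by (intro exI[of _ "insert e E"]) (auto simp: e_def)
qed

lemma orthonormal_basis_exists:
  assumes "finite_dimensional_vector_space sc B"
  shows "\<exists>E. finite E \<and> card E = card B \<and> span E = UNIV \<and>
    (\<forall>x\<in>E. \<forall>y\<in>E. ip x y = (if x = y then 1 else 0))"
proof -
  interpret fd: finite_dimensional_vector_space sc B by (fact assms)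
  obtain E where E: "finite E" "card E = card B" "\<forall>x\<in>E. \<forall>y\<in>E. ip x y = (if x = y then 1 else 0)"
    using orthonormal_set_exists[OF assms order_refl] by blast
  then have "independent E" by (intro independent_orthonormal) auto
  then have "UNIV \<subseteq> span E"
    using E by (intro fd.card_ge_dim_independent) (auto simp: fd.dim_UNIV fd.dimension_def)
  with E show ?thesis by blast
qed

text \<open>The expansion \<open>y\<close> has the same products with \<open>E\<close> as
  \<open>x\<close>, so \<open>x - y\<close> is orthogonal to everything, itself included.\<close>

lemma parseval:
  assumes "finite E" and "span E = UNIV"
    and E: "\<And>x y. x \<in> E \<Longrightarrow> y \<in> E \<Longrightarrow> ip x y = (if x = y then 1 else 0)"
  shows "norm (ip x x) = (\<Sum>e\<in>E. (norm (ip x e))\<^sup>2)"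
proof -
  define y where "y = (\<Sum>e\<in>E. sc (ip x e) e)"
  have "ip (x - y) e = 0" if "e \<in> E" for e
  proof -
    have "ip y e = (\<Sum>e'\<in>E. if e' = e then ip x e' else 0)"
      unfolding y_def ip_sum_left ip_scale_left by (rule sum.cong) (use that E in auto)
    also have "\<dots> = ip x e" using assms(1) that by simp
    finally show ?thesis by (simp add: ip_diff_left)
  qed
  then have "ip (x - y) (x - y) = 0"
    using ip_span_eq_0[of "x - y" E] assms(2) by blast
  then have "x = y" by (simp add: ip_self_eq_0)
  then have "ip x x = ip x y" by simp
  also have "\<dots> = (\<Sum>e\<in>E. of_real ((norm (ip x e))\<^sup>2))"
    unfolding y_def ip_sum_right ip_scale_right
    by (intro sum.cong refl) (metis mult_conjugate mult.commute)
  also have "\<dots> = of_real (\<Sum>e\<in>E. (norm (ip x e))\<^sup>2)" by simp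
  finally show ?thesis by (simp only: norm_of_real) (auto intro!: abs_of_nonneg sum_nonneg)
qed

text \<open>By Parseval the lower bound reduces to the finitely many \<open>e\<close> in
  \<open>E\<close>, each in the span of the list. The upper bound is the same estimate for each list
  entry in terms of \<open>E\<close>.\<close>

lemma finite_frame_if_spanning:
  assumes "finite_dimensional_vector_space sc B" and "span (set fs) = UNIV"
  shows "finite_frame ip fs"
proof -
  obtain E where E: "finite E" "span E = UNIV"
    "\<And>x y. x \<in> E \<Longrightarrow> y \<in> E \<Longrightarrow> ip x y = (if x = y then 1 else 0)"
    using orthonormal_basis_exists[OF assms(1)] by blast
  have P: "norm (ip x x) = (\<Sum>e\<in>E. (norm (ip x e))\<^sup>2)" for x
    by (rule parseval) (fact E)+
  define Q where "Q x = (\<Sum>i<length fs. (norm (ip x (fs ! i)))\<^sup>2)" for x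
  have img: "(!) fs ` {..<length fs} = set fs" by (auto simp: set_conv_nth)
  have "\<exists>C. 0 < C \<and> (\<forall>x. (norm (ip x e))\<^sup>2 \<le> C * Q x)" for e
    using norm_ip_span_bound[of "{..<length fs}" e "(!) fs"] assms(2) unfolding Q_def img by simp
  then obtain C where C: "\<And>e. 0 < C e" "\<And>e x. (norm (ip x e))\<^sup>2 \<le> C e * Q x" by metis
  have "\<exists>D. 0 < D \<and> (\<forall>x. (norm (ip x y))\<^sup>2 \<le> D * norm (ip x x))" for y
    using norm_ip_span_bound[of E y id] E(1,2) by (simp add: P)
  then obtain D where D: "\<And>y. 0 < D y" "\<And>x y. (norm (ip x y))\<^sup>2 \<le> D y * norm (ip x x)" by metis
  \<comment> \<open>The summand 1 keeps \<open>A\<close> and \<open>K\<close> at least 1 even for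
    empty sums, so that \<open>1 / A \<le> 1 \<le> K\<close>.\<close>
  define A where "A = (\<Sum>e\<in>E. C e) + 1"
  define K where "K = (\<Sum>i<length fs. D (fs ! i)) + 1"
  have "0 \<le> (\<Sum>e\<in>E. C e)" using C(1) by (intro sum_nonneg) (auto intro: less_imp_le)
  then have A: "1 \<le> A" by (simp add: A_def)
  have "0 \<le> (\<Sum>i<length fs. D (fs ! i))" using D(1) by (intro sum_nonneg) (auto intro: less_imp_le)
  then have K: "1 \<le> K" by (simp add: K_def)
  have Qnn: "0 \<le> Q x" for x unfolding Q_def by (intro sum_nonneg) auto
  have lower: "norm (ip x x) \<le> A * Q x" for x
  proof -
    have "norm (ip x x) \<le> (\<Sum>e\<in>E. C e * Q x)" unfolding P by (intro sum_mono C(2))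
    also have "\<dots> \<le> A * Q x" by (simp add: A_def distrib_right Qnn sum_distrib_right)
    finally show ?thesis .
  qed
  have upper: "Q x \<le> K * norm (ip x x)" for x
  proof -
    have "Q x \<le> (\<Sum>i<length fs. D (fs ! i) * norm (ip x x))" unfolding Q_def by (intro sum_mono D(2))
    also have "\<dots> \<le> K * norm (ip x x)" by (simp add: K_def distrib_right sum_distrib_right)
    finally show ?thesis .
  qed
  have "1 / A * norm (ip x x) \<le> Q x" for x using lower[of x] A by (simp add: field_simps)
  moreover have "1 / A \<le> K" using A K by (smt (verit) divide_le_eq_1)
  ultimately show ?thesis
    unfolding finite_frame_def using upper A
    by (intro exI[of _ "1 / A"] exI[of _ K]) (auto simp: Q_def)
qed

end

section \<open>Frame graphs\<close>

text \<open>An unordered pair may be read in either order; the condition is the same because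
  orthogonality is symmetric.\<close>

lemma edge_frame_graph_iff:
  assumes "inner_product_space sc ip"
  shows "{i, j} \<in> edges (frame_graph ip fs) \<longleftrightarrow>
    i < length fs \<and> j < length fs \<and> i \<noteq> j \<and> ip (fs ! i) (fs ! j) \<noteq> 0"
  using inner_product_space.ip_eq_0_sym[OF assms]
  by (auto simp: frame_graph_def doubleton_eq_iff)

text \<open>Trades the list and the isomorphism for a family indexed by the vertices, keeping of the
  frame property only that no nonzero vector is orthogonal to the family.\<close>

lemma is_frame_graph_inD:
  assumes ip: "inner_product_space sc ip" and "is_frame_graph_in G ip"
  obtains F where "\<And>x. (\<And>v. v \<in> verts G \<Longrightarrow> ip x (F v) = 0) \<Longrightarrow> x = 0"
    and "\<And>u v. u \<in> verts G \<Longrightarrow> v \<in> verts G \<Longrightarrow> u \<noteq> v \<Longrightarrow> ip (F u) (F v) \<noteq> 0 \<longleftrightarrow> {u, v} \<in> edges G"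
proof -
  interpret inner_product_space sc ip by (fact ip)
  obtain fs h where fs: "finite_frame ip fs" and h: "bij_betw h {..<length fs} (verts G)"
    and e: "\<And>i j. i < length fs \<Longrightarrow> j < length fs \<Longrightarrow>
      {i, j} \<in> edges (frame_graph ip fs) \<longleftrightarrow> {h i, h j} \<in> edges G"
    using assms(2) unfolding is_frame_graph_in_def graph_isomorphic_def
    by (auto simp: frame_graph_def)
  define k where "k = inv_into {..<length fs} h"
  have k: "k v < length fs" "h (k v) = v" if "v \<in> verts G" for v
    using that h inv_into_into[of v h "{..<length fs}"] f_inv_into_f[of v h "{..<length fs}"]
    unfolding k_def bij_betw_def by auto
  have kh: "k (h i) = i" if "i < length fs" for i
    using that h unfolding k_def bij_betw_def by auto
  show thesis
  proof
    fix x assume x: "\<And>v. v \<in> verts G \<Longrightarrow> ip x (fs ! k v) = 0"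
    have "ip x (fs ! i) = 0" if "i < length fs" for i
      using x[of "h i"] kh[OF that] bij_betwE[OF h] that by auto
    then show "x = 0" by (intro finite_frame_orthogonal_trivial[OF fs]) (auto simp: in_set_conv_nth)
  next
    fix u v assume "u \<in> verts G" "v \<in> verts G" "u \<noteq> v"
    then show "ip (fs ! k u) (fs ! k v) \<noteq> 0 \<longleftrightarrow> {u, v} \<in> edges G"
      using e[of "k u" "k v"] k[of u] k[of v] edge_frame_graph_iff[OF ip, of "k u" "k v" fs] by metis
  qed
qed

text \<open>\<open>loopfree\<close> settles the singletons that \<open>graph_isomorphic\<close>
  compares when \<open>u = v\<close>: frame graphs have no loops.\<close>

lemma (in real_or_complex_ip_space) is_frame_graph_inI:
  assumes "finite_dimensional_vector_space sc B" and "finite (verts G)"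
    and loopfree: "\<And>v. {v} \<notin> edges G" and span: "span (F ` verts G) = UNIV"
    and edge: "\<And>u v. u \<in> verts G \<Longrightarrow> v \<in> verts G \<Longrightarrow> u \<noteq> v \<Longrightarrow>
      ip (F u) (F v) \<noteq> 0 \<longleftrightarrow> {u, v} \<in> edges G"
  shows "is_frame_graph_in G ip"
proof -
  obtain vs where vs: "set vs = verts G" "distinct vs"
    using finite_distinct_list[OF assms(2)] by blast
  have "finite_frame ip (map F vs)"
    using assms(1) span vs by (intro finite_frame_if_spanning) auto
  moreover have "graph_isomorphic (frame_graph ip (map F vs)) G"
    unfolding graph_isomorphic_def
  proof (intro exI[of _ "(!) vs"] conjI ballI)
    show "bij_betw ((!) vs) (verts (frame_graph ip (map F vs))) (verts G)"
      using vs by (simp add: frame_graph_def bij_betw_nth)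
  next
    fix i j assume "i \<in> verts (frame_graph ip (map F vs))" "j \<in> verts (frame_graph ip (map F vs))"
    then have ij: "i < length vs" "j < length vs" by (auto simp: frame_graph_def)
    have mem: "vs ! i \<in> verts G" "vs ! j \<in> verts G" using ij vs(1) nth_mem by blast+
    show "{i, j} \<in> edges (frame_graph ip (map F vs)) \<longleftrightarrow> {vs ! i, vs ! j} \<in> edges G"
    proof (cases "i = j")
      case True
      then show ?thesis
        using loopfree by (simp add: edge_frame_graph_iff[OF inner_product_space_axioms, of j j, simplified])
    next
      case False
      then have "vs ! i \<noteq> vs ! j" using vs(2) ij nth_eq_iff_index_eq by blast
      then show ?thesis
        using edge[OF mem] ij False
        by (simp add: edge_frame_graph_iff[OF inner_product_space_axioms])
    qed
  qed
  ultimately show ?thesis unfolding is_frame_graph_in_def by blast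
qed

section \<open>Strong products of paths\<close>

lemma verts_path_graph: "verts (path_graph n) = {..<n}"
  by (simp add: path_graph_def)

lemma edge_path_graph_iff:
  "{i, j} \<in> edges (path_graph n) \<longleftrightarrow> i < n \<and> j < n \<and> (j = Suc i \<or> i = Suc j)"
  by (auto simp: path_graph_def doubleton_eq_iff)

text \<open>The edges are the moves of a chess king on an \<open>n\<close> by \<open>m\<close>
  board.\<close>

abbreviation (input) king_graph :: "nat \<Rightarrow> nat \<Rightarrow> (nat \<times> nat) graph" where
  "king_graph n m \<equiv> strong_product (path_graph n) (path_graph m)"

lemma verts_king_graph: "verts (king_graph n m) = {..<n} \<times> {..<m}"
  by (simp add: strong_product_def verts_path_graph)

text \<open>Turns adjacency into linear arithmetic: equal or consecutive means a difference of at
  most one, and excluding equality in both coordinates leaves the three cases of the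
  product.\<close>

lemma edge_king_graph_iff:
  "{(a, b), (c, d)} \<in> edges (king_graph n m) \<longleftrightarrow>
     a < n \<and> c < n \<and> b < m \<and> d < m \<and> (a, b) \<noteq> (c, d) \<and>
     a \<le> Suc c \<and> c \<le> Suc a \<and> b \<le> Suc d \<and> d \<le> Suc b"
proof -
  have iff: "{(a, b), (c, d)} \<in> edges (king_graph n m) \<longleftrightarrow>
     a < n \<and> c < n \<and> b < m \<and> d < m \<and>
     (a = c \<and> {b, d} \<in> edges (path_graph m) \<or>
      b = d \<and> {a, c} \<in> edges (path_graph n) \<or>
      {a, c} \<in> edges (path_graph n) \<and> {b, d} \<in> edges (path_graph m))"
    (is "?L \<longleftrightarrow> ?R")
  proof
    assume ?L
    then obtain u v u' v' where eq: "{(a, b), (c, d)} = {(u, v), (u', v')}"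
      and *: "u < n" "u' < n" "v < m" "v' < m"
        "u = u' \<and> {v, v'} \<in> edges (path_graph m) \<or>
         v = v' \<and> {u, u'} \<in> edges (path_graph n) \<or>
         {u, u'} \<in> edges (path_graph n) \<and> {v, v'} \<in> edges (path_graph m)"
      unfolding strong_product_def snd_conv mem_Collect_eq verts_path_graph lessThan_iff by blast
    from eq consider "a = u" "b = v" "c = u'" "d = v'" | "a = u'" "b = v'" "c = u" "d = v"
      unfolding doubleton_eq_iff by blast
    then show ?R
    proof cases
      case 1
      then show ?thesis using * by blast
    next
      case 2
      \<comment> \<open>The pairs match in swapped order, and the adjacency condition is
        symmetric.\<close>
      then show ?thesis using * unfolding insert_commute[of u] insert_commute[of v] by blast
    qed
  next
    assume ?R
    then show ?L
      unfolding strong_product_def snd_conv mem_Collect_eq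
      by (intro exI[of _ a] exI[of _ b] exI[of _ c] exI[of _ d]) (simp add: verts_path_graph)
  qed
  have near: "x \<le> Suc y \<and> y \<le> Suc x \<longleftrightarrow> x = y \<or> (y = Suc x \<or> x = Suc y)" for x y :: nat
    by auto
  show ?thesis
    unfolding iff edge_path_graph_iff prod.inject using near[of a c] near[of b d]
    by (cases "a = c"; cases "b = d"; simp; blast)
qed

lemma loopfree_king_graph: "{v} \<notin> edges (king_graph n m)"
  using edge_king_graph_iff[of "fst v" "snd v" "fst v" "snd v"] by simp

section \<open>Dimension bounds forced by a frame\<close>

lemma king_graph_frame_dim_bounds:
  assumes ip: "inner_product_space sc ip" and fd: "finite_dimensional_vector_space sc B"
    and frame: "is_frame_graph_in (king_graph n m) ip"
  shows "(n - 1) * (m - 1) \<le> card B" and "card B \<le> m * n"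
proof -
  interpret inner_product_space sc ip by (fact ip)
  interpret fd: finite_dimensional_vector_space sc B by (fact fd)
  let ?V = "{..<n} \<times> {..<m}"
  obtain F where F0: "\<And>x. (\<And>v. v \<in> ?V \<Longrightarrow> ip x (F v) = 0) \<Longrightarrow> x = 0"
    and F: "\<And>u v. u \<in> ?V \<Longrightarrow> v \<in> ?V \<Longrightarrow> u \<noteq> v \<Longrightarrow>
      ip (F u) (F v) \<noteq> 0 \<longleftrightarrow> {u, v} \<in> edges (king_graph n m)"
    using is_frame_graph_inD[OF ip frame] unfolding verts_king_graph by blast
  have "span (F ` ?V) = UNIV"
    by (rule span_eq_UNIV_if_orthogonal_trivial) (use F0 in auto)
  then have "dim (UNIV :: 'b set) \<le> card (F ` ?V)" by (intro dim_le_card) auto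
  also have "\<dots> \<le> card ?V" by (rule card_image_le) simp
  finally show "card B \<le> m * n" by (simp add: fd.dim_UNIV fd.dimension_def mult.commute)
  \<comment> \<open>Dropping the last value of each coordinate keeps the partner
    \<open>(i + 1, j + 1)\<close> inside the grid.\<close>
  let ?I = "{..<n - 1} \<times> {..<m - 1}"
  let ?g = "\<lambda>(i, j). F (Suc i, Suc j)" and ?r = "\<lambda>(i, j). i + j"
  \<comment> \<open>If \<open>(a, b)\<close> is the partner of \<open>(c, d)\<close>, the product is
    that of a vector with itself, about which adjacency says nothing. In either case a nonzero
    product gives \<open>c \<le> a\<close> and \<open>d \<le> b\<close>.\<close>
  have edge: "ip (F (a, b)) (?g (c, d)) \<noteq> 0 \<longleftrightarrow>
      (a, b) = (Suc c, Suc d) \<and> F (a, b) \<noteq> 0 \<or>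
      (a, b) \<noteq> (Suc c, Suc d) \<and> c \<le> a \<and> a \<le> Suc (Suc c) \<and> d \<le> b \<and> b \<le> Suc (Suc d)"
    if "(a, b) \<in> ?I" "(c, d) \<in> ?I" for a b c d
  proof (cases "(a, b) = (Suc c, Suc d)")
    case False
    have "a < n" "b < m" "Suc c < n" "Suc d < m" using that by auto
    then show ?thesis using F[OF _ _ False] False by (simp add: edge_king_graph_iff) blast
  qed (simp add: ip_self_eq_0)
  have nz: "ip (F i) (?g i) \<noteq> 0" if "i \<in> ?I" for i
    using edge[of "fst i" "snd i" "fst i" "snd i"] that by (cases i) auto
  \<comment> \<open>Both coordinates of \<open>j\<close> are at least those of \<open>i\<close>, one
    of them strictly as \<open>i \<noteq> j\<close>.\<close>
  have tri: "?r i < ?r j" if "i \<in> ?I" "j \<in> ?I" "i \<noteq> j" "ip (F j) (?g i) \<noteq> 0" for i j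
    using edge[of "fst j" "snd j" "fst i" "snd i"] that by (cases i; cases j) auto
  have "card ?I = card (F ` ?I)" "independent (F ` ?I)"
    using independent_triangular[of ?I F ?g ?r] nz tri by (auto simp: card_image)
  then show "(n - 1) * (m - 1) \<le> card B"
    using fd.independent_card_le_dim[of "F ` ?I" UNIV]
    by (simp add: fd.dim_UNIV fd.dimension_def)
qed

section \<open>A frame in every admissible dimension\<close>

lemma (in real_or_complex_ip_space) king_graph_frame_exists:
  assumes fd: "finite_dimensional_vector_space sc B" and nm: "2 \<le> n" "2 \<le> m"
    and d: "(n - 1) * (m - 1) \<le> card B" "card B \<le> m * n"
  shows "is_frame_graph_in (king_graph n m) ip"
proof -
  let ?V = "{..<n} \<times> {..<m}" and ?Q = "{..<n - 1} \<times> {..<m - 1}"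
  have QV: "?Q \<subseteq> ?V" by auto
  have "\<exists>I. ?Q \<subseteq> I \<and> I \<subseteq> ?V \<and> card I = card B"
    by (rule exists_subset_between) (use d QV in \<open>auto simp: mult.commute\<close>)
  then obtain I where I: "?Q \<subseteq> I" "I \<subseteq> ?V" "card I = card B" by blast
  have finI: "finite I" using I(2) finite_subset by blast
  obtain E where E: "finite E" "card E = card B" "span E = UNIV"
    "\<And>x y. x \<in> E \<Longrightarrow> y \<in> E \<Longrightarrow> ip x y = (if x = y then 1 else 0)"
    using orthonormal_basis_exists[OF fd] by blast
  obtain b where b: "bij_betw b I E"
    using finite_same_card_bij[OF finI E(1)] I(3) E(2) by auto
  have ipb: "ip (b p) (b q) = (if p = q then 1 else 0)" if "p \<in> I" "q \<in> I" for p q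
    using that b E(4) unfolding bij_betw_def inj_on_def by (metis imageI)
  \<comment> \<open>\<open>p = v\<close> is the vertex's own index, if selected; the other disjunct
    collects the unit squares containing \<open>v\<close>, labelled by their lower left
    corners.\<close>
  define S where "S v = {p \<in> I. p = v \<or> p \<in> ?Q \<and>
    fst p \<le> fst v \<and> fst v \<le> Suc (fst p) \<and> snd p \<le> snd v \<and> snd v \<le> Suc (snd p)}" for v
  define F where "F v = (\<Sum>p\<in>S v. b p)" for v
  have finS: "finite (S v)" and SI: "S v \<subseteq> I" for v using finI by (auto simp: S_def)
  have ipF: "ip (F u) (F v) = of_nat (card (S u \<inter> S v))" for u v
  proof -
    have "ip (F u) (F v) = (\<Sum>p\<in>S u. \<Sum>q\<in>S v. ip (b p) (b q))"
      unfolding F_def by (subst ip_sum_left, subst ip_sum_right) (rule refl)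
    also have "\<dots> = (\<Sum>p\<in>S u. \<Sum>q\<in>S v. if p = q then 1 else 0)"
      using SI by (intro sum.cong refl ipb) blast+
    also have "\<dots> = (\<Sum>p\<in>S u. if p \<in> S v then 1 else 0)"
      using finS by simp
    also have "\<dots> = of_nat (card (S u \<inter> S v))"
      using finS by (simp flip: sum.inter_restrict)
    finally show ?thesis .
  qed
  show ?thesis
  proof (rule is_frame_graph_inI[OF fd])
    show "finite (verts (king_graph n m))" by (simp add: verts_king_graph)
    show "{v} \<notin> edges (king_graph n m)" for v by (rule loopfree_king_graph)
    \<comment> \<open>\<open>F p\<close> is \<open>b p\<close> plus basis vectors whose indices have
      smaller coordinate sum, so back-substitution recovers each \<open>b p\<close>.\<close>
    have bspan: "b p \<in> span (F ` ?V)" if "p \<in> I" for p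
      using that
    proof (induction "fst p + snd p" arbitrary: p rule: less_induct)
      case less
      have "p \<in> S p" using less.prems by (simp add: S_def)
      then have "F p = b p + (\<Sum>q\<in>S p - {p}. b q)"
        unfolding F_def using finS by (simp add: sum.remove)
      then have eq: "b p = F p - (\<Sum>q\<in>S p - {p}. b q)" by simp
      have "b q \<in> span (F ` ?V)" if "q \<in> S p - {p}" for q
      proof (rule less.hyps)
        show "fst q + snd q < fst p + snd p"
          using that by (cases q; cases p) (auto simp: S_def)
      qed (use that SI in blast)
      moreover have "F p \<in> span (F ` ?V)" using less.prems I(2) by (intro span_base) auto
      ultimately show ?case unfolding eq by (intro span_diff span_sum)
    qed
    then have "E \<subseteq> span (F ` ?V)" using b unfolding bij_betw_def by auto
    then have "span E \<subseteq> span (F ` ?V)" by (rule span_minimal) simp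
    then show "span (F ` verts (king_graph n m)) = UNIV" using E(3) by (auto simp: verts_king_graph)
  next
    fix u v assume uv: "u \<in> verts (king_graph n m)" "v \<in> verts (king_graph n m)" "u \<noteq> v"
    obtain i j k l where ijkl: "u = (i, j)" "v = (k, l)" by (cases u; cases v)
    have bd: "i < n" "j < m" "k < n" "l < m" using uv by (auto simp: verts_king_graph ijkl)
    have "S u \<inter> S v \<noteq> {} \<longleftrightarrow> i \<le> Suc k \<and> k \<le> Suc i \<and> j \<le> Suc l \<and> l \<le> Suc j"
    proof
      assume "S u \<inter> S v \<noteq> {}"
      \<comment> \<open>Distinct vertices cannot both equal the shared index, so it labels a unit
        square, and that square contains both.\<close>
      then show "i \<le> Suc k \<and> k \<le> Suc i \<and> j \<le> Suc l \<and> l \<le> Suc j"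
        using uv(3) by (auto simp: S_def ijkl)
    next
      assume a: "i \<le> Suc k \<and> k \<le> Suc i \<and> j \<le> Suc l \<and> l \<le> Suc j"
      \<comment> \<open>The minimum of \<open>r\<close> and \<open>s\<close> starts a unit interval
        containing both; the cap \<open>N - 2\<close> is for \<open>r = s = N - 1\<close>, where
        that interval would leave the path.\<close>
      have "\<exists>x<N - 1. x \<le> r \<and> r \<le> Suc x \<and> x \<le> s \<and> s \<le> Suc x"
        if "r < N" "s < N" "r \<le> Suc s" "s \<le> Suc r" "2 \<le> N" for r s N :: nat
        using that by (intro exI[of _ "min (min r s) (N - 2)"]) (auto simp: min_def)
      then obtain x y where "x < n - 1" "x \<le> i" "i \<le> Suc x" "x \<le> k" "k \<le> Suc x"
        "y < m - 1" "y \<le> j" "j \<le> Suc y" "y \<le> l" "l \<le> Suc y" using a bd nm by meson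
      then have "(x, y) \<in> S u \<inter> S v" using I(1) by (auto simp: S_def ijkl)
      then show "S u \<inter> S v \<noteq> {}" by blast
    qed
    \<comment> \<open>The product is a cardinality, which stays nonzero in characteristic
      zero.\<close>
    moreover have "ip (F u) (F v) \<noteq> 0 \<longleftrightarrow> S u \<inter> S v \<noteq> {}"
      using finS by (simp add: ipF)
    ultimately show "ip (F u) (F v) \<noteq> 0 \<longleftrightarrow> {u, v} \<in> edges (king_graph n m)"
      using uv(3) bd by (simp add: ijkl edge_king_graph_iff)
  qed
qed

section \<open>The real and the complex case\<close>

lemma real_or_complex_ip_space_real:
  fixes sc :: "real \<Rightarrow> 'v::ab_group_add \<Rightarrow> 'v"
  assumes "inner_product_space sc ip"
  shows "real_or_complex_ip_space sc ip"
  using assms unfolding real_or_complex_ip_space_def real_or_complex_ip_space_axioms_def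
  by (auto simp: power2_eq_square)

text \<open>In the order on the complex numbers, a positive number has imaginary part zero, hence
  equals its modulus.\<close>

lemma real_or_complex_ip_space_complex:
  fixes sc :: "complex \<Rightarrow> 'v::ab_group_add \<Rightarrow> 'v"
  assumes "inner_product_space sc ip"
  shows "real_or_complex_ip_space sc ip"
  using assms unfolding real_or_complex_ip_space_def real_or_complex_ip_space_axioms_def
  by (auto simp: complex_norm_square less_complex_def complex_eq_iff norm_complex_def power2_eq_square)

lemma king_graph_frame_iff:
  assumes "real_or_complex_ip_space sc ip" and "inner_product_space_of_dim d sc ip"
    and "2 \<le> n" and "2 \<le> m"
  shows "is_frame_graph_in (king_graph n m) ip \<longleftrightarrow> (n - 1) * (m - 1) \<le> d \<and> d \<le> m * n"
  using assms king_graph_frame_dim_bounds real_or_complex_ip_space.king_graph_frame_exists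
  unfolding inner_product_space_of_dim_def by metis

theorem theorem3p3:
  fixes n m d :: nat
  assumes "n \<ge> 2" and "m \<ge> 2" and "d \<ge> 1"
  shows
    "(\<forall>(sc :: real \<Rightarrow> 'v::ab_group_add \<Rightarrow> 'v) ip.
        inner_product_space_of_dim d sc ip \<longrightarrow>
        (is_frame_graph_in (strong_product (path_graph n) (path_graph m)) ip \<longleftrightarrow>
         (n - 1) * (m - 1) \<le> d \<and> d \<le> m * n)) \<and>
     (\<forall>(sc :: complex \<Rightarrow> 'w::ab_group_add \<Rightarrow> 'w) ip.
        inner_product_space_of_dim d sc ip \<longrightarrow>
        (is_frame_graph_in (strong_product (path_graph n) (path_graph m)) ip \<longleftrightarrow>
         (n - 1) * (m - 1) \<le> d \<and> d \<le> m * n))"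
proof (intro conjI allI impI)
  fix sc :: "real \<Rightarrow> 'v \<Rightarrow> 'v" and ip assume "inner_product_space_of_dim d sc ip"
  then show "is_frame_graph_in (king_graph n m) ip \<longleftrightarrow> (n - 1) * (m - 1) \<le> d \<and> d \<le> m * n"
    using king_graph_frame_iff[OF real_or_complex_ip_space_real] assms
    unfolding inner_product_space_of_dim_def by blast
next
  fix sc :: "complex \<Rightarrow> 'w \<Rightarrow> 'w" and ip assume "inner_product_space_of_dim d sc ip"
  then show "is_frame_graph_in (king_graph n m) ip \<longleftrightarrow> (n - 1) * (m - 1) \<le> d \<and> d \<le> m * n"
    using king_graph_frame_iff[OF real_or_complex_ip_space_complex] assms
    unfolding inner_product_space_of_dim_def by blast
qed

end
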